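(* Let $\mathbf F=\{F_\gamma:\gamma\in T^*\}$ be a weight system for the cascade generator $\{W_\gamma:\gamma\in T^*\}$ on $(\Omega,\mathcal F,P)$, with $Z_\emptyset=E_P[W_\emptyset F_\emptyset]>0$. Let $\mathcal Q_{\mathbf F}$ be the associated probability on $\Omega\times T$, let $\pi_\Omega:\Omega\times T\to\Omega$ be the coordinate projection, and let $\lambda_{\mathbf F,\infty}(T)=\limsup_{n\to\infty}\lambda_{\mathbf F,n}(T)\in[0,\infty]$. Then, as measures on $(\Omega,\mathcal F)$, $$d(\mathcal Q_{\mathbf F}\circ\pi_\Omega^{-1})=Z_\emptyset^{-1}\,\lambda_{\mathbf F,\infty}(T)\,\mathbf 1(\lambda_{\mathbf F,\infty}(T)<\infty)\,dP+\mathbf 1(\lambda_{\mathbf F,\infty}(T)=\infty)\,d(\mathcal Q_{\mathbf F}\circ\pi_\Omega^{-1}).$$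
   Context: Tree. Fix an integer $b\ge2$. $T=\{0,\dots,b-1\}^{\mathbb N}$ with the product topology (a compact metric space) and Borel $\sigma$-field $\mathcal B(T)$; $\lambda$ is the normalized Haar measure on $T$ (the product of uniform measures). $T^*$ is the set of all finite words over $\{0,\dots,b-1\}$, including the empty word $\emptyset$ (the root). $|\gamma|$ is the length of $\gamma\in T^*$. For $t\in T$, $t|n=(t_1,\dots,t_n)$, $t|0=\emptyset$; for $\gamma\in T^*$ and $j\le|\gamma|$, $\gamma|j$ is the prefix of length $j$. $\Delta_\gamma=\{t\in T: t|{|\gamma|}=\gamma\}$. Cascade generator. Given a probability measure $p_0(dx)$ on $[0,\infty)$ and transition probability kernels $q_n(dx|x_0,\dots,x_{n-1})$, $n\ge1$, on $[0,\infty)$, each of mean one ($\int x\,q_n(dx|x_0,\dots,x_{n-1})=1$), let $\Omega=[0,\infty)^{T^*}$ with product $\sigma$-field $\mathcal F$, let $W_\gamma(\omega)=\omega_\gamma$ and $\mathcal F_n=\sigma\{W_\gamma:|\gamma|\le n\}$, and let $P$ be the probability on $(\Omega,\mathcal F)$ such that: $W_\emptyset$ has law $p_0$; for every $t\in T$ and $n\ge0$ the conditional law of $W_{t|n+1}$ given $\mathcal F_n$ is $q_{n+1}(dx|W_{t|0},\dots,W_{t|n})$; and the variables $W_\gamma$, $|\gamma|=n+1$, are conditionally independent given $\mathcal F_n$. Positive $T$-martingale. A sequence $\{Q_n(t)\}$ of nonnegative functions on $T\times\Omega$ such that for every $t\in T$, $\{Q_n(t)\}_n$ is a martingale with respect to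 $(\mathcal F_n)$ under $P$, and for $P$-a.e. $\omega$ the functions $Q_n(\cdot,\omega)$ are Borel. Weight system. A family $\mathbf F=\{F_\gamma:\gamma\in T^*\}$ of functions $F_\gamma:\Omega\to[0,\infty)$ with $F_\gamma$ measurable with respect to $\sigma\{W_{\gamma|j}:0\le j\le|\gamma|\}$ and such that $$Q_{\mathbf F,n}(t)=\Big(\prod_{j=0}^nW_{t|j}\Big)F_{t|n},\qquad n\ge0,\ t\in T,$$ is a positive $T$-martingale. Put $\lambda_{\mathbf F,n}(dt)=Q_{\mathbf F,n}(t)\lambda(dt)$. The probability $\mathcal Q_{\mathbf F}$. Put $Z_\emptyset=E_P[W_\emptyset F_\emptyset]$, assumed $>0$. $\mathcal Q_{\mathbf F}$ is the unique probability on $(\Omega\times T,\mathcal F\otimes\mathcal B(T))$ such that for each $n\ge0$ and each bounded $\mathcal F_n\otimes\mathcal B(T)$-measurable $f$, $$\int f\,d\mathcal Q_{\mathbf F}=Z_\emptyset^{-1}E_P\int_Tf(\omega,t)Q_{\mathbf F,n}(t)\,\lambda(dt).$$ *)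

theory Defs
  imports "HOL-Probability.Probability"
begin

section \<open>The tree\<close>

definition words :: "nat \<Rightarrow> nat list set" where
  "words b = lists {..<b}"

definition tree_boundary_topology :: "nat \<Rightarrow> (nat \<Rightarrow> nat) topology" where
  "tree_boundary_topology b = product_topology (\<lambda>_. discrete_topology {..<b}) UNIV"

text \<open>The space \<open>T\<close> with its normalized Haar measure, the product of the uniform measures. Its
  \<open>\<sigma>\<close>-algebra is by construction the product one; \<open>sets_haar\<close> below shows that it is the Borel
  \<open>\<sigma>\<close>-algebra. Coordinates are indexed from 0, so \<open>t 0\<close> is the first letter of \<open>t\<close>.\<close>

definition haar :: "nat \<Rightarrow> (nat \<Rightarrow> nat) measure" where
  "haar b = (\<Pi>\<^sub>M i\<in>UNIV. uniform_count_measure {..<b})"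

definition trunc :: "(nat \<Rightarrow> nat) \<Rightarrow> nat \<Rightarrow> nat list" where
  "trunc t n = map t [0..<n]"

lemma space_haar: "space (haar b) = (UNIV \<rightarrow> {..<b})"
  by (simp add: haar_def space_PiM PiE_UNIV_domain space_uniform_count_measure)

lemma topspace_tree_boundary_topology:
  "topspace (tree_boundary_topology b) = space (haar b)"
  by (auto simp: tree_boundary_topology_def space_haar PiE_UNIV_domain)

lemma sets_haar:
  "sets (haar b) = sigma_sets (space (haar b)) {U. openin (tree_boundary_topology b) U}"
proof
  let ?X = "space (haar b)" and ?O = "{U. openin (tree_boundary_topology b) U}"
  have cyl: "openin (tree_boundary_topology b) {f \<in> ?X. f i \<in> A}" if "A \<subseteq> {..<b}" for i A
  proof -
    have "continuous_map (tree_boundary_topology b) (discrete_topology {..<b}) (\<lambda>f. f i)"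
      unfolding tree_boundary_topology_def
      by (rule continuous_map_product_projection) simp
    from openin_continuous_map_preimage[OF this, of A] that show ?thesis
      by (simp add: topspace_tree_boundary_topology)
  qed
  have "sets (haar b) = sigma_sets ?X {{f \<in> ?X. f i \<in> A} | i A. A \<subseteq> {..<b}}"
    unfolding haar_def sets_PiM_single space_PiM
    by (simp add: space_uniform_count_measure sets_uniform_count_measure)
  also have "\<dots> \<subseteq> sigma_sets ?X ?O"
    using cyl by (intro sigma_sets_mono') auto
  finally show "sets (haar b) \<subseteq> sigma_sets ?X ?O" .
  have "U \<in> sets (haar b)" if U: "openin (tree_boundary_topology b) U" for U
  proof -
    have UX: "U \<subseteq> ?X"
      using openin_subset[OF U] by (simp add: topspace_tree_boundary_topology)
    define C where "C \<gamma> = {f \<in> ?X. \<forall>i<length \<gamma>. f i = \<gamma> ! i}" for \<gamma> :: "nat list"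
    have C_sets: "C \<gamma> \<in> sets (haar b)" for \<gamma>
    proof -
      have "{f \<in> ?X. f i = k} \<in> sets (haar b)" for i k
      proof -
        have "{f \<in> ?X. f i \<in> {k} \<inter> {..<b}} \<in> sets (haar b)"
          unfolding haar_def by (rule sets_Collect_single) (auto simp: sets_uniform_count_measure)
        also have "{f \<in> ?X. f i \<in> {k} \<inter> {..<b}} = {f \<in> ?X. f i = k}"
          by (auto simp: space_haar)
        finally show ?thesis .
      qed
      then show ?thesis
        unfolding C_def by (intro sets.sets_Collect_countable_All sets.sets_Collect_imp) auto
    qed
    have "\<exists>\<gamma>. x \<in> C \<gamma> \<and> C \<gamma> \<subseteq> U" if x: "x \<in> U" for x
    proof -
      from U x obtain V where V: "finite {i. V i \<noteq> {..<b}}" "x \<in> Pi\<^sub>E UNIV V" "Pi\<^sub>E UNIV V \<subseteq> U"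
        unfolding tree_boundary_topology_def openin_product_topology_alt by force
      from V(1) obtain n where n: "\<And>i. V i \<noteq> {..<b} \<Longrightarrow> i < n"
        using finite_nat_set_iff_bounded by auto
      have "x \<in> C (map x [0..<n])"
        using x UX by (auto simp: C_def)
      moreover have "C (map x [0..<n]) \<subseteq> Pi\<^sub>E UNIV V"
      proof
        fix f assume f: "f \<in> C (map x [0..<n])"
        have "f i \<in> V i" for i
        proof (cases "i < n")
          case True
          then have "f i = x i" using f by (auto simp: C_def)
          then show ?thesis using V(2) by (auto simp: PiE_UNIV_domain)
        next
          case False
          then have "V i = {..<b}" using n by blast
          then show ?thesis using f by (auto simp: C_def space_haar)
        qed
        then show "f \<in> Pi\<^sub>E UNIV V" by (auto simp: PiE_UNIV_domain)
      qed
      ultimately show ?thesis using V(3) by blast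
    qed
    then have "U = (\<Union>\<gamma>\<in>{\<gamma>. C \<gamma> \<subseteq> U}. C \<gamma>)" by blast
    also have "\<dots> \<in> sets (haar b)"
      using C_sets by (intro sets.countable_UN') auto
    finally show ?thesis .
  qed
  then show "sigma_sets ?X ?O \<subseteq> sets (haar b)"
    by (intro sets.sigma_sets_subset) auto
qed


section \<open>Conditional laws, conditional independence, martingales\<close>

text \<open>\<open>G\<close> is a sub-\<open>\<sigma>\<close>-algebra of \<open>P\<close>, given (as in the library) by a measure whose values play
  no role.\<close>

definition has_cond_law ::
  "'w measure \<Rightarrow> 'w measure \<Rightarrow> 'x measure \<Rightarrow> ('w \<Rightarrow> 'x) \<Rightarrow> ('w \<Rightarrow> 'x measure) \<Rightarrow> bool" where
  "has_cond_law P G N X K \<longleftrightarrow>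
     (\<forall>A\<in>sets N. AE \<omega> in P. real_cond_exp P G (indicator (X -` A \<inter> space P)) \<omega> = measure (K \<omega>) A)"

definition cond_indep_vars ::
  "'w measure \<Rightarrow> 'w measure \<Rightarrow> 'x measure \<Rightarrow> ('i \<Rightarrow> 'w \<Rightarrow> 'x) \<Rightarrow> 'i set \<Rightarrow> bool" where
  "cond_indep_vars P G N X I \<longleftrightarrow>
     (\<forall>J A. J \<subseteq> I \<longrightarrow> finite J \<longrightarrow> (\<forall>i\<in>J. A i \<in> sets N) \<longrightarrow>
       (AE \<omega> in P. real_cond_exp P G (\<lambda>\<omega>'. \<Prod>i\<in>J. indicator (X i -` A i \<inter> space P) \<omega>') \<omega>
          = (\<Prod>i\<in>J. real_cond_exp P G (indicator (X i -` A i \<inter> space P)) \<omega>)))"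

definition martingale_wrt ::
  "'w measure \<Rightarrow> (nat \<Rightarrow> 'w measure) \<Rightarrow> (nat \<Rightarrow> 'w \<Rightarrow> real) \<Rightarrow> bool" where
  "martingale_wrt P G X \<longleftrightarrow>
     (\<forall>n. X n \<in> borel_measurable (G n) \<and> integrable P (X n)) \<and>
     (\<forall>m n. m \<le> n \<longrightarrow> (AE \<omega> in P. real_cond_exp P (G m) (X n) \<omega> = X m \<omega>))"


section \<open>Cascade generators\<close>

definition half_line :: "real measure" where
  "half_line = restrict_space borel {0..}"

definition config_space :: "nat \<Rightarrow> (nat list \<Rightarrow> real) measure" where
  "config_space b = (\<Pi>\<^sub>M \<gamma>\<in>words b. half_line)"

definition W :: "nat list \<Rightarrow> (nat list \<Rightarrow> real) \<Rightarrow> real" where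
  "W \<gamma> \<omega> = \<omega> \<gamma>"

definition sigma_W :: "nat \<Rightarrow> nat list set \<Rightarrow> (nat list \<Rightarrow> real) measure" where
  "sigma_W b S = sigma (space (config_space b))
     {W \<gamma> -` A \<inter> space (config_space b) | \<gamma> A. \<gamma> \<in> S \<and> A \<in> sets half_line}"

definition filt :: "nat \<Rightarrow> nat \<Rightarrow> (nat list \<Rightarrow> real) measure" where
  "filt b n = sigma_W b {\<gamma> \<in> words b. length \<gamma> \<le> n}"

text \<open>A history \<open>(x\<^sub>0, \<dots>, x\<^bsub>n-1\<^esub>)\<close> is an extensional function on \<open>{..<n}\<close>, and \<open>q n\<close> with \<open>n \<ge> 1\<close> is
  the \<open>n\<close>-th kernel; \<open>q 0\<close> is never used. The mean of \<open>p0\<close> is not constrained.\<close>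

definition cascade_generator ::
  "nat \<Rightarrow> real measure \<Rightarrow> (nat \<Rightarrow> (nat \<Rightarrow> real) \<Rightarrow> real measure) \<Rightarrow> (nat list \<Rightarrow> real) measure \<Rightarrow> bool"
where
  "cascade_generator b p0 q P \<longleftrightarrow>
     p0 \<in> space (prob_algebra half_line) \<and>
     (\<forall>n\<ge>1. q n \<in> (\<Pi>\<^sub>M j\<in>{..<n}. half_line) \<rightarrow>\<^sub>M prob_algebra half_line \<and>
        (\<forall>x\<in>space (\<Pi>\<^sub>M j\<in>{..<n}. half_line). (\<integral>\<^sup>+ y. ennreal y \<partial>q n x) = 1)) \<and>
     prob_space P \<and> sets P = sets (config_space b) \<and>
     distr P half_line (W []) = p0 \<and>
     (\<forall>t\<in>space (haar b). \<forall>n. has_cond_law P (filt b n) half_line (W (trunc t (Suc n)))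
        (\<lambda>\<omega>. q (Suc n) (\<lambda>j\<in>{..<Suc n}. W (trunc t j) \<omega>))) \<and>
     (\<forall>n. cond_indep_vars P (filt b n) half_line W {\<gamma> \<in> words b. length \<gamma> = Suc n})"


section \<open>Weight systems\<close>

definition positive_T_martingale ::
  "nat \<Rightarrow> (nat list \<Rightarrow> real) measure \<Rightarrow> (nat \<Rightarrow> (nat \<Rightarrow> nat) \<Rightarrow> (nat list \<Rightarrow> real) \<Rightarrow> real) \<Rightarrow> bool"
where
  "positive_T_martingale b P Q \<longleftrightarrow>
     (\<forall>n. \<forall>t\<in>space (haar b). \<forall>\<omega>\<in>space (config_space b). 0 \<le> Q n t \<omega>) \<and>
     (\<forall>t\<in>space (haar b). martingale_wrt P (filt b) (\<lambda>n. Q n t)) \<and>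
     (AE \<omega> in P. \<forall>n. (\<lambda>t. Q n t \<omega>) \<in> borel_measurable (haar b))"

definition QF ::
  "(nat list \<Rightarrow> (nat list \<Rightarrow> real) \<Rightarrow> real) \<Rightarrow> nat \<Rightarrow> (nat \<Rightarrow> nat) \<Rightarrow> (nat list \<Rightarrow> real) \<Rightarrow> real" where
  "QF F n t \<omega> = (\<Prod>j\<le>n. W (trunc t j) \<omega>) * F (trunc t n) \<omega>"

definition weight_system ::
  "nat \<Rightarrow> (nat list \<Rightarrow> real) measure \<Rightarrow> (nat list \<Rightarrow> (nat list \<Rightarrow> real) \<Rightarrow> real) \<Rightarrow> bool" where
  "weight_system b P F \<longleftrightarrow>
     (\<forall>\<gamma>\<in>words b. F \<gamma> \<in> sigma_W b {take j \<gamma> | j. j \<le> length \<gamma>} \<rightarrow>\<^sub>M half_line) \<and>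
     positive_T_martingale b P (QF F)"

definition lambdaF ::
  "nat \<Rightarrow> (nat list \<Rightarrow> (nat list \<Rightarrow> real) \<Rightarrow> real) \<Rightarrow> nat \<Rightarrow> (nat list \<Rightarrow> real) \<Rightarrow> (nat \<Rightarrow> nat) measure"
where
  "lambdaF b F n \<omega> = density (haar b) (\<lambda>t. ennreal (QF F n t \<omega>))"

definition lambdaF_inf_T ::
  "nat \<Rightarrow> (nat list \<Rightarrow> (nat list \<Rightarrow> real) \<Rightarrow> real) \<Rightarrow> (nat list \<Rightarrow> real) \<Rightarrow> ennreal" where
  "lambdaF_inf_T b F \<omega> = limsup (\<lambda>n. emeasure (lambdaF b F n \<omega>) (space (haar b)))"

definition Z_root ::
  "(nat list \<Rightarrow> real) measure \<Rightarrow> (nat list \<Rightarrow> (nat list \<Rightarrow> real) \<Rightarrow> real) \<Rightarrow> real" where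
  "Z_root P F = (\<integral>\<omega>. W [] \<omega> * F [] \<omega> \<partial>P)"

text \<open>The defining property of the probability \<open>\<Q>\<^sub>F\<close> on \<open>\<Omega> \<times> T\<close>, which determines it.\<close>

definition is_cascade_prob ::
  "nat \<Rightarrow> (nat list \<Rightarrow> real) measure \<Rightarrow> (nat list \<Rightarrow> (nat list \<Rightarrow> real) \<Rightarrow> real)
    \<Rightarrow> ((nat list \<Rightarrow> real) \<times> (nat \<Rightarrow> nat)) measure \<Rightarrow> bool" where
  "is_cascade_prob b P F \<Q> \<longleftrightarrow>
     prob_space \<Q> \<and> sets \<Q> = sets (config_space b \<Otimes>\<^sub>M haar b) \<and>
     (\<forall>n. \<forall>f::(nat list \<Rightarrow> real) \<times> (nat \<Rightarrow> nat) \<Rightarrow> real.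
        f \<in> borel_measurable (filt b n \<Otimes>\<^sub>M haar b) \<longrightarrow>
        bounded (f ` space (config_space b \<Otimes>\<^sub>M haar b)) \<longrightarrow>
        (\<integral>z. f z \<partial>\<Q>)
          = inverse (Z_root P F) * (\<integral>\<omega>. (\<integral>t. f (\<omega>, t) * QF F n t \<omega> \<partial>haar b) \<partial>P))"

end

theory Submission
  imports Defs
begin

text \<open>
  Write \<open>\<mu>\<close> for the \<open>\<Omega>\<close>-marginal of \<open>\<Q>\<close> and \<open>L\<close> for the limsup of the total masses of the
  \<open>\<lambda>\<^bsub>F,n\<^esub>\<close>. On each \<open>\<F>\<^sub>n\<close> the measure \<open>\<mu>\<close> has density \<open>\<lambda>\<^bsub>F,n\<^esub>(T)\<close> with respect to
  \<open>P' = Z\<inverse> P\<close>: test the defining property of \<open>\<Q>\<close> on the indicator of \<open>A \<times> T\<close>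
  (\<open>cascade_prob_filt\<close>). The rest is the Lebesgue decomposition of a measure along a filtration that
  generates the whole \<open>\<sigma>\<close>-algebra, where only the identity \<open>\<mu> = L P'\<close> on \<open>{L < \<infinity>}\<close> needs proof
  (\<open>density_limsup\<close>): on \<open>{L = \<infinity>}\<close> both sides are \<open>\<mu>\<close>.

  That identity is proved as in the differentiation theory of measures, in place of martingale
  convergence. If two finite measures satisfy \<open>\<phi> \<le> \<psi>\<close> on all \<open>\<F>\<^sub>n\<close>-measurable subsets of \<open>H\<^sub>n\<close>,
  for every \<open>n\<close>, then \<open>\<phi> \<le> \<psi>\<close> on all measurable subsets of \<open>limsup H\<^sub>n\<close>: cut the set
  according to the first time at which \<open>H\<^sub>n\<close> is hit (\<open>frequent_domination\<close>). With \<open>H\<^sub>n\<close> one of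
  \<open>{M\<^sub>n < c}\<close> and \<open>{M\<^sub>n > c}\<close>, \<open>M\<^sub>n\<close> being the density on \<open>\<F>\<^sub>n\<close>, this gives \<open>\<mu> \<le> c P'\<close> on
  \<open>{L < c}\<close> and \<open>c P' \<le> \<mu>\<close> on \<open>{L > c}\<close>. Cutting \<open>{L < \<infinity>}\<close> into thin level sets of \<open>L\<close>
  identifies \<open>\<mu>\<close> with \<open>L P'\<close> there.
\<close>

section \<open>Comparing two measures along a filtration\<close>

text \<open>
  Sets that are approximable by members of the \<open>\<F>\<^sub>m\<close> form a \<open>\<sigma>\<close>-algebra. The approximation has to
  work for two measures with the same set, because the domination argument below transfers an
  inequality from that set to \<open>A\<close> on both sides.
\<close>

lemma approx_by_filtration:
  fixes \<phi> \<psi> :: "'a measure" and F :: "nat \<Rightarrow> 'a measure"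
  assumes \<phi>: "finite_measure \<phi>" and \<psi>: "finite_measure \<psi>" and sets_\<psi>: "sets \<psi> = sets \<phi>"
    and filt: "filtration (space \<phi>) F"
    and gen: "sets \<phi> = sigma_sets (space \<phi>) (\<Union>n. sets (F n))"
    and A: "A \<in> sets \<phi>" and e: "(0::real) < e"
  shows "\<exists>m. \<exists>B\<in>sets (F m). measure \<phi> (sym_diff A B) < e \<and> measure \<psi> (sym_diff A B) < e"
proof -
  interpret \<phi>: finite_measure \<phi> by (rule \<phi>)
  interpret \<psi>: finite_measure \<psi> by (rule \<psi>)
  interpret filtration "space \<phi>" F by (rule filt)
  have F_sets: "B \<in> sets \<phi>" if "B \<in> sets (F n)" for B n
    using that unfolding gen by (auto intro: sigma_sets.Basic)
  have "A \<in> sigma_sets (space \<phi>) (\<Union>n. sets (F n))"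
    using A gen by simp
  then show ?thesis
    using e
  proof (induction arbitrary: e rule: sigma_sets.induct)
    case (Basic A)
    then show ?case by force
  next
    case Empty
    then show ?case by (intro exI[of _ 0] bexI[of _ "{}"]) auto
  next
    case (Compl A)
    from Compl.IH[OF Compl.prems] obtain m B
      where B: "B \<in> sets (F m)" "measure \<phi> (sym_diff A B) < e" "measure \<psi> (sym_diff A B) < e"
      by blast
    have "A \<subseteq> space \<phi>"
      using Compl.hyps gen sets.sets_into_space by blast
    moreover have "B \<subseteq> space \<phi>"
      using sets.sets_into_space[OF B(1)] by (simp add: space_F)
    ultimately have "sym_diff (space \<phi> - A) (space \<phi> - B) = sym_diff A B"
      by blast
    with B show ?case
      by (intro exI[of _ m] bexI[of _ "space \<phi> - B"]) (auto simp: space_F[of m, symmetric])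
  next
    case (Union A)
    have A_sets [measurable]: "A i \<in> sets \<phi>" for i
      using Union.hyps gen by simp
    \<comment> \<open>The tails \<open>R n\<close> decrease to the empty set, so finitely many of the \<open>A i\<close> suffice up to
      \<open>e / 2\<close>; the other half is shared by the approximations of those \<open>A i\<close>.\<close>
    define R where "R n = (\<Union>i. A i) - (\<Union>i<n. A i)" for n
    have R_sets: "R n \<in> sets \<phi>" for n
      unfolding R_def by measurable
    have R_dec: "decseq R" and R_empty: "(\<Inter>n. R n) = {}"
      by (force simp: R_def decseq_def)+
    have "(\<lambda>n. measure \<phi> (R n)) \<longlonglongrightarrow> 0" "(\<lambda>n. measure \<psi> (R n)) \<longlonglongrightarrow> 0"
      using \<phi>.finite_Lim_measure_decseq[OF _ R_dec] \<psi>.finite_Lim_measure_decseq[OF _ R_dec] R_sets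
      by (auto simp: R_empty sets_\<psi>)
    then have "\<forall>\<^sub>F n in sequentially. measure \<phi> (R n) < e / 2 \<and> measure \<psi> (R n) < e / 2"
      using Union.prems by (intro eventually_conj order_tendstoD(2)) auto
    then obtain n where n: "measure \<phi> (R n) < e / 2" "measure \<psi> (R n) < e / 2"
      by (auto simp: eventually_sequentially)
    define d where "d = e / (2 * (real n + 1))"
    have "0 < d" using Union.prems by (simp add: d_def)
    from Union.IH[OF this] obtain k B where
      B: "\<And>i. B i \<in> sets (F (k i))"
         "\<And>i. measure \<phi> (sym_diff (A i) (B i)) < d" "\<And>i. measure \<psi> (sym_diff (A i) (B i)) < d"
      by metis
    define m where "m = Max (k ` {..n})"
    have B_m: "B i \<in> sets (F m)" if "i < n" for i
      using B(1)[of i] sets_F_mono[of "k i" m] that by (auto simp: m_def)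
    have cover: "sym_diff (\<Union>i. A i) (\<Union>i<n. B i) \<subseteq> R n \<union> (\<Union>i<n. sym_diff (A i) (B i))"
      by (auto simp: R_def)
    have small: "measure \<rho> (sym_diff (\<Union>i. A i) (\<Union>i<n. B i)) < e"
      if \<rho>: "finite_measure \<rho>" and sets_\<rho>: "sets \<rho> = sets \<phi>" and R: "measure \<rho> (R n) < e / 2"
        and AB: "\<And>i. measure \<rho> (sym_diff (A i) (B i)) < d" for \<rho>
    proof -
      interpret \<rho>: finite_measure \<rho> by (rule \<rho>)
      have [measurable]: "A i \<in> sets \<rho>" "B i \<in> sets \<rho>" "R n \<in> sets \<rho>" for i
        using A_sets F_sets[OF B(1)] R_sets by (simp_all add: sets_\<rho>)
      have "measure \<rho> (sym_diff (\<Union>i. A i) (\<Union>i<n. B i))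
              \<le> measure \<rho> (R n \<union> (\<Union>i<n. sym_diff (A i) (B i)))"
        by (intro \<rho>.finite_measure_mono[OF cover]) measurable
      also have "\<dots> \<le> measure \<rho> (R n) + measure \<rho> (\<Union>i<n. sym_diff (A i) (B i))"
        by (intro measure_Un_le) auto
      also have "measure \<rho> (\<Union>i<n. sym_diff (A i) (B i)) \<le> (\<Sum>i<n. measure \<rho> (sym_diff (A i) (B i)))"
        by (intro measure_UNION_le) auto
      also have "\<dots> \<le> (\<Sum>i<n. d)"
        by (intro sum_mono less_imp_le AB)
      also have "\<dots> \<le> e / 2"
        using Union.prems by (simp add: d_def field_simps)
      finally show ?thesis using R by simp
    qed
    have "(\<Union>i<n. B i) \<in> sets (F m)"
      using B_m by auto
    with small[OF \<phi> refl n(1) B(2)] small[OF \<psi> sets_\<psi> n(2) B(3)] show ?case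
      by blast
  qed
qed

text \<open>
  First replace \<open>A\<close> by some \<open>B \<in> \<F>\<^sub>m\<close> close to it. A point of \<open>A \<inter> B\<close> lies in some \<open>H\<^sub>n\<close> with
  \<open>n \<ge> m\<close>, so the sets \<open>D\<^sub>n\<close> of points of \<open>B\<close> whose first visit from time \<open>m\<close> on happens at time
  \<open>m + n\<close> cover \<open>A \<inter> B\<close>. They are disjoint, and since \<open>B \<in> \<F>\<^sub>m\<close> each \<open>D\<^sub>n\<close> belongs to
  \<open>\<F>\<^bsub>m+n\<^esub>\<close>, where the two measures can be compared.
\<close>

lemma frequent_domination:
  fixes \<phi> \<psi> :: "'a measure" and F :: "nat \<Rightarrow> 'a measure"
  assumes \<phi>: "finite_measure \<phi>" and \<psi>: "finite_measure \<psi>" and sets_\<psi>: "sets \<psi> = sets \<phi>"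
    and filt: "filtration (space \<phi>) F"
    and gen: "sets \<phi> = sigma_sets (space \<phi>) (\<Union>n. sets (F n))"
    and H: "\<And>n. H n \<in> sets (F n)"
    and le: "\<And>n B. B \<in> sets (F n) \<Longrightarrow> B \<subseteq> H n \<Longrightarrow> emeasure \<phi> B \<le> emeasure \<psi> B"
    and A: "A \<in> sets \<phi>" "A \<subseteq> limsup H"
  shows "emeasure \<phi> A \<le> emeasure \<psi> A"
proof -
  interpret \<phi>: finite_measure \<phi> by (rule \<phi>)
  interpret \<psi>: finite_measure \<psi> by (rule \<psi>)
  interpret filtration "space \<phi>" F by (rule filt)
  have F_sets: "B \<in> sets \<phi>" if "B \<in> sets (F n)" for B n
    using that unfolding gen by (auto intro: sigma_sets.Basic)
  have *: "measure \<phi> A \<le> measure \<psi> A + 2 * e" if "0 < e" for e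
  proof -
    from approx_by_filtration[OF \<phi> \<psi> sets_\<psi> filt gen A(1) that] obtain m B
      where B: "B \<in> sets (F m)" "measure \<phi> (sym_diff A B) < e" "measure \<psi> (sym_diff A B) < e"
      by blast
    define K where "K n = B \<inter> H (m + n)" for n
    define D where "D = disjointed K"
    have K_F: "K i \<in> sets (F (m + n))" if "i \<le> n" for i n
      using B(1) H[of "m + i"] sets_F_mono[of m "m + n"] sets_F_mono[of "m + i" "m + n"] that
      by (auto simp: K_def)
    have D_F: "D n \<in> sets (F (m + n))" for n
      unfolding D_def disjointed_def by (intro sets.Diff sets.finite_UN K_F) auto
    have [measurable]: "A \<in> sets \<phi>" "B \<in> sets \<phi>" "A \<in> sets \<psi>" "B \<in> sets \<psi>"
      "\<And>n. D n \<in> sets \<phi>" "\<And>n. D n \<in> sets \<psi>"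
      using A(1) F_sets[OF B(1)] F_sets[OF D_F] by (auto simp: sets_\<psi>)
    have D_disj: "disjoint_family D"
      unfolding D_def by (rule disjoint_family_disjointed)
    have UD: "(\<Union>n. D n) = (\<Union>n. K n)"
      by (simp add: D_def UN_disjointed_eq)
    have hit: "A \<inter> B \<subseteq> (\<Union>n. D n)"
    proof
      fix x assume x: "x \<in> A \<inter> B"
      then have "\<exists>\<^sub>F n in sequentially. x \<in> H n"
        using A(2) by (auto simp: mem_limsup_iff[symmetric])
      then obtain n where "n \<ge> m" "x \<in> H n"
        by (auto simp: frequently_sequentially)
      then have "x \<in> K (n - m)" using x by (simp add: K_def)
      then show "x \<in> (\<Union>n. D n)" unfolding UD by blast
    qed
    have "emeasure \<phi> (\<Union>n. D n) = (\<Sum>n. emeasure \<phi> (D n))"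
      by (intro suminf_emeasure[symmetric]) (auto simp: D_disj)
    also have "\<dots> \<le> (\<Sum>n. emeasure \<psi> (D n))"
      using disjointed_subset[of K] by (intro suminf_le le[OF D_F]) (auto simp: D_def K_def)
    also have "\<dots> = emeasure \<psi> (\<Union>n. D n)"
      by (intro suminf_emeasure) (auto simp: D_disj)
    finally have D_le: "measure \<phi> (\<Union>n. D n) \<le> measure \<psi> (\<Union>n. D n)"
      by (simp add: \<phi>.emeasure_eq_measure \<psi>.emeasure_eq_measure)
    have "measure \<phi> A \<le> measure \<phi> ((\<Union>n. D n) \<union> sym_diff A B)"
      using hit by (intro \<phi>.finite_measure_mono) auto
    also have "\<dots> \<le> measure \<phi> (\<Union>n. D n) + measure \<phi> (sym_diff A B)"
      by (intro measure_Un_le) auto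
    also have "measure \<phi> (\<Union>n. D n) \<le> measure \<psi> (A \<union> sym_diff A B)"
      by (rule order_trans[OF D_le], rule \<psi>.finite_measure_mono) (auto simp: UD K_def)
    also have "\<dots> \<le> measure \<psi> A + measure \<psi> (sym_diff A B)"
      by (intro measure_Un_le) auto
    finally show ?thesis using B by simp
  qed
  have "measure \<phi> A \<le> measure \<psi> A"
  proof (rule field_le_epsilon)
    fix e :: real assume "0 < e"
    with *[of "e / 2"] show "measure \<phi> A \<le> measure \<psi> A + e" by simp
  qed
  then show ?thesis
    by (simp add: \<phi>.emeasure_eq_measure \<psi>.emeasure_eq_measure)
qed

section \<open>The absolutely continuous part is the limsup of the densities\<close>

text \<open>
  \<open>upper\<close> and \<open>lower\<close> compare \<open>\<mu>\<close> with multiples of \<open>P\<close> where \<open>L\<close> is small or large. On the level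
  sets \<open>G k = {k h \<le> L < (k + 1) h}\<close> they pin down both \<open>\<mu>\<close> and \<open>L P\<close> up to the error
  \<open>2 h P(G k)\<close>. As \<open>P\<close> is finite, these errors add up to at most \<open>2 h P(A)\<close>, which vanishes with
  \<open>h\<close>.
\<close>

lemma density_limsup:
  fixes P \<mu> :: "'a measure" and F :: "nat \<Rightarrow> 'a measure" and M :: "nat \<Rightarrow> 'a \<Rightarrow> ennreal"
  assumes P: "finite_measure P" and \<mu>: "finite_measure \<mu>" and sets_\<mu>: "sets \<mu> = sets P"
    and filt: "filtration (space P) F"
    and gen: "sets P = sigma_sets (space P) (\<Union>n. sets (F n))"
    and M: "\<And>n. M n \<in> borel_measurable (F n)"
    and dens: "\<And>n B. B \<in> sets (F n) \<Longrightarrow> emeasure \<mu> B = (\<integral>\<^sup>+x\<in>B. M n x \<partial>P)"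
    and A: "A \<in> sets P" "\<And>x. x \<in> A \<Longrightarrow> limsup (\<lambda>n. M n x) < \<infinity>"
  shows "emeasure \<mu> A = (\<integral>\<^sup>+x\<in>A. limsup (\<lambda>n. M n x) \<partial>P)"
proof -
  interpret P: finite_measure P by (rule P)
  interpret \<mu>: finite_measure \<mu> by (rule \<mu>)
  interpret filtration "space P" F by (rule filt)
  define L where "L x = limsup (\<lambda>n. M n x)" for x
  have F_sets: "B \<in> sets P" if "B \<in> sets (F n)" for B n
    using that unfolding gen by (auto intro: sigma_sets.Basic)
  have "subalgebra P (F n)" for n
    using F_sets by (auto simp: subalgebra_def space_F)
  then have M_P [measurable]: "M n \<in> borel_measurable P" for n
    using M measurable_from_subalg by blast
  have L [measurable]: "L \<in> borel_measurable P"
    unfolding L_def by measurable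
  have fin_scale: "finite_measure (scale_measure (ennreal c) P)" for c
    by (intro finite_measureI) (simp add: ennreal_mult_eq_top_iff space_scale_measure)
  have space_\<mu>: "space \<mu> = space P"
    by (rule sets_eq_imp_space_eq[OF sets_\<mu>])
  have upper: "emeasure \<mu> B \<le> ennreal c * emeasure P B"
    if B: "B \<in> sets P" and L_less: "\<And>x. x \<in> B \<Longrightarrow> L x < ennreal c" for B c
  proof -
    let ?H = "\<lambda>n. {x \<in> space P. M n x < ennreal c}"
    have "emeasure \<mu> B \<le> emeasure (scale_measure (ennreal c) P) B"
    proof (rule frequent_domination[where F = F and H = ?H])
      show "?H n \<in> sets (F n)" for n
        using M[of n] unfolding space_F[of n, symmetric] by measurable
      show "B \<subseteq> limsup ?H"
      proof
        fix x assume "x \<in> B"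
        then have "\<forall>\<^sub>F n in sequentially. M n x < ennreal c"
          using L_less[of x] unfolding L_def by (intro Limsup_lessD) auto
        then show "x \<in> limsup ?H"
          using \<open>x \<in> B\<close> sets.sets_into_space[OF B]
          by (auto simp: mem_limsup_iff intro!: eventually_frequently)
      qed
      fix n C assume C: "C \<in> sets (F n)" "C \<subseteq> ?H n"
      have "emeasure \<mu> C \<le> (\<integral>\<^sup>+x. ennreal c * indicator C x \<partial>P)"
        unfolding dens[OF C(1)] using C(2)
        by (intro nn_integral_mono) (auto split: split_indicator)
      then show "emeasure \<mu> C \<le> emeasure (scale_measure (ennreal c) P) C"
        using F_sets[OF C(1)] by (simp add: nn_integral_cmult_indicator)
    qed (use \<mu> fin_scale filt gen B in \<open>simp_all add: sets_\<mu> space_\<mu>\<close>)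
    then show ?thesis by simp
  qed
  have lower: "ennreal c * emeasure P B \<le> emeasure \<mu> B"
    if B: "B \<in> sets P" and L_gt: "\<And>x. x \<in> B \<Longrightarrow> ennreal c < L x" for B c
  proof -
    let ?H = "\<lambda>n. {x \<in> space P. ennreal c < M n x}"
    have "emeasure (scale_measure (ennreal c) P) B \<le> emeasure \<mu> B"
    proof (rule frequent_domination[where F = F and H = ?H])
      show "?H n \<in> sets (F n)" for n
        using M[of n] unfolding space_F[of n, symmetric] by measurable
      show "B \<subseteq> limsup ?H"
      proof
        fix x assume "x \<in> B"
        have "\<exists>\<^sub>F n in sequentially. ennreal c < M n x"
        proof (rule ccontr)
          assume "\<not> ?thesis"
          then have "\<forall>\<^sub>F n in sequentially. M n x \<le> ennreal c"
            by (simp add: not_frequently not_less)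
          then have "L x \<le> ennreal c"
            unfolding L_def by (rule Limsup_bounded)
          with L_gt[OF \<open>x \<in> B\<close>] show False by simp
        qed
        then show "x \<in> limsup ?H"
          using \<open>x \<in> B\<close> sets.sets_into_space[OF B] by (auto simp: mem_limsup_iff)
      qed
      fix n C assume C: "C \<in> sets (F n)" "C \<subseteq> ?H n"
      have "(\<integral>\<^sup>+x. ennreal c * indicator C x \<partial>P) \<le> emeasure \<mu> C"
        unfolding dens[OF C(1)] using C(2)
        by (intro nn_integral_mono) (auto split: split_indicator)
      then show "emeasure (scale_measure (ennreal c) P) C \<le> emeasure \<mu> C"
        using F_sets[OF C(1)] by (simp add: nn_integral_cmult_indicator)
    qed (use \<mu> fin_scale filt gen B in \<open>simp_all add: sets_\<mu> space_scale_measure\<close>)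
    then show ?thesis by simp
  qed
  define \<nu> where "\<nu> = density P L"
  have glue: "emeasure \<alpha> A \<le> emeasure \<beta> A + ennreal r * emeasure P A"
    if \<alpha>: "sets \<alpha> = sets P" and \<beta>: "sets \<beta> = sets P"
      and G: "\<And>k. G k \<in> sets P" "disjoint_family G" "(\<Union>k. G k) = A"
      and le: "\<And>k::nat. emeasure \<alpha> (G k) \<le> emeasure \<beta> (G k) + ennreal r * emeasure P (G k)"
    for \<alpha> \<beta> r G
  proof -
    have "emeasure \<alpha> A = (\<Sum>k. emeasure \<alpha> (G k))"
      unfolding G(3)[symmetric] using G(1,2) by (intro suminf_emeasure[symmetric]) (auto simp: \<alpha>)
    also have "\<dots> \<le> (\<Sum>k. emeasure \<beta> (G k) + ennreal r * emeasure P (G k))"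
      by (intro suminf_le le) auto
    also have "\<dots> = (\<Sum>k. emeasure \<beta> (G k)) + ennreal r * (\<Sum>k. emeasure P (G k))"
      by (simp add: suminf_add[symmetric])
    also have "\<dots> = emeasure \<beta> A + ennreal r * emeasure P A"
      unfolding G(3)[symmetric] using G(1,2)
      by (intro arg_cong2[where f = "(+)"] arg_cong2[where f = "(*)"] suminf_emeasure)
         (auto simp: \<beta>)
    finally show ?thesis .
  qed
  have near: "emeasure \<mu> A \<le> emeasure \<nu> A + ennreal (2 * h) * emeasure P A \<and>
      emeasure \<nu> A \<le> emeasure \<mu> A + ennreal (2 * h) * emeasure P A" if h: "0 < h" for h :: real
  proof -
    define G where "G k = {x \<in> A. ennreal (real k * h) \<le> L x \<and> L x < ennreal (real (Suc k) * h)}" for k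
    have A_sub: "A \<subseteq> space P" using A(1) by (rule sets.sets_into_space)
    have G_sets [measurable]: "G k \<in> sets P" for k
    proof -
      have "G k = A \<inter> {x \<in> space P. ennreal (real k * h) \<le> L x \<and> L x < ennreal (real (Suc k) * h)}"
        using A_sub by (auto simp: G_def)
      also have "\<dots> \<in> sets P" using A(1) by measurable
      finally show ?thesis .
    qed
    have G_floor: "x \<in> G k \<longleftrightarrow> x \<in> A \<and> k = nat \<lfloor>enn2real (L x) / h\<rfloor>" for x k
    proof (cases "x \<in> A")
      case True
      then obtain l where l: "L x = ennreal l" "0 \<le> l"
        using A(2)[of x] by (cases "L x") (auto simp: L_def)
      have "0 \<le> real (Suc k) * h" using h by simp
      with True l h have "x \<in> G k \<longleftrightarrow> real k * h \<le> l \<and> l < real (Suc k) * h"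
        unfolding G_def by (simp only: mem_Collect_eq ennreal_le_iff ennreal_less_iff simp_thms)
      also have "\<dots> \<longleftrightarrow> real k \<le> l / h \<and> l / h < real k + 1"
        using h by (simp add: field_simps)
      also have "\<dots> \<longleftrightarrow> \<lfloor>l / h\<rfloor> = int k"
        by (simp add: floor_eq_iff)
      also have "\<dots> \<longleftrightarrow> k = nat \<lfloor>l / h\<rfloor>"
        using l(2) h by auto
      finally show ?thesis using True l by simp
    qed (simp add: G_def)
    have G_disj: "disjoint_family G" and G_UN: "(\<Union>k. G k) = A"
      by (auto simp: disjoint_family_on_def G_floor)
    have \<nu>_G: "emeasure \<nu> (G k) = (\<integral>\<^sup>+x\<in>G k. L x \<partial>P)" for k
      unfolding \<nu>_def by (intro emeasure_density) auto
    have \<nu>_up: "emeasure \<nu> (G k) \<le> ennreal (real (Suc k) * h) * emeasure P (G k)" for k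
    proof -
      have "emeasure \<nu> (G k) \<le> (\<integral>\<^sup>+x. ennreal (real (Suc k) * h) * indicator (G k) x \<partial>P)"
        unfolding \<nu>_G by (intro nn_integral_mono) (auto simp: G_def split: split_indicator)
      then show ?thesis by (simp add: nn_integral_cmult_indicator)
    qed
    have \<nu>_lo: "ennreal (real k * h) * emeasure P (G k) \<le> emeasure \<nu> (G k)" for k
    proof -
      have "(\<integral>\<^sup>+x. ennreal (real k * h) * indicator (G k) x \<partial>P) \<le> emeasure \<nu> (G k)"
        unfolding \<nu>_G by (intro nn_integral_mono) (auto simp: G_def split: split_indicator)
      then show ?thesis by (simp add: nn_integral_cmult_indicator)
    qed
    have \<mu>_up: "emeasure \<mu> (G k) \<le> ennreal (real (Suc k) * h) * emeasure P (G k)" for k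
      by (intro upper G_sets) (auto simp: G_def)
    \<comment> \<open>The strict inequality that \<open>lower\<close> asks for fails at \<open>c = k h\<close>. Going down one level
      restores it, at the price of the factor 2 in the error.\<close>
    have \<mu>_lo: "ennreal ((real k - 1) * h) * emeasure P (G k) \<le> emeasure \<mu> (G k)" for k
    proof (cases "k = 0")
      case True
      with h show ?thesis by (simp add: ennreal_neg)
    next
      case False
      show ?thesis
      proof (intro lower G_sets)
        fix x assume "x \<in> G k"
        have "ennreal ((real k - 1) * h) < ennreal (real k * h)"
          using False h by (intro ennreal_lessI) auto
        with \<open>x \<in> G k\<close> show "ennreal ((real k - 1) * h) < L x"
          by (auto simp: G_def)
      qed
    qed
    have step: "ennreal (real (Suc k) * h) * emeasure P (G k)
        \<le> ennreal ((real k - 1) * h) * emeasure P (G k) + ennreal (2 * h) * emeasure P (G k)" for k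
    proof -
      have "ennreal (real (Suc k) * h) \<le> ennreal ((real k - 1) * h) + ennreal (2 * h)"
      proof (cases k)
        case 0
        with h show ?thesis by (simp add: ennreal_neg ennreal_leI)
      next
        case (Suc j)
        have "real (Suc k) * h = (real k - 1) * h + 2 * h" by (simp add: algebra_simps)
        moreover have "0 \<le> (real k - 1) * h" using Suc h by simp
        ultimately show ?thesis using h by simp
      qed
      then show ?thesis
        by (metis distrib_right mult_right_mono zero_le)
    qed
    have "ennreal ((real k - 1) * h) * emeasure P (G k) \<le> emeasure \<nu> (G k)" for k
      using h by (intro order_trans[OF mult_right_mono \<nu>_lo] ennreal_leI) auto
    then have "emeasure \<mu> (G k) \<le> emeasure \<nu> (G k) + ennreal (2 * h) * emeasure P (G k)"
      and "emeasure \<nu> (G k) \<le> emeasure \<mu> (G k) + ennreal (2 * h) * emeasure P (G k)" for k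
      using order_trans[OF \<mu>_up order_trans[OF step add_right_mono]]
        order_trans[OF \<nu>_up order_trans[OF step add_right_mono[OF \<mu>_lo]]] by blast+
    then show ?thesis
      using G_sets G_disj G_UN by (intro conjI glue[of _ _ G]) (auto simp: sets_\<mu> \<nu>_def)
  qed
  have close: "s \<le> t"
    if "\<And>h::real. 0 < h \<Longrightarrow> s \<le> t + ennreal (2 * h) * emeasure P A" for s t :: ennreal
  proof (rule ennreal_le_epsilon)
    fix e :: real assume "0 < e"
    define h where "h = e / (2 * (measure P A + 1))"
    have pos: "0 < measure P A + 1" using measure_nonneg[of P A] by linarith
    have "0 < h" using \<open>0 < e\<close> pos by (simp add: h_def)
    have "2 * h * measure P A \<le> e"
      using \<open>0 < e\<close> pos by (simp add: h_def field_simps)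
    then have "ennreal (2 * h) * emeasure P A \<le> ennreal e"
      using \<open>0 < h\<close> by (simp add: P.emeasure_eq_measure ennreal_leI flip: ennreal_mult)
    with that[OF \<open>0 < h\<close>] show "s \<le> t + ennreal e"
      by (meson add_left_mono order_trans)
  qed
  have "emeasure \<mu> A = emeasure \<nu> A"
    by (rule antisym; rule close) (use near in blast)+
  also have "\<dots> = (\<integral>\<^sup>+x\<in>A. L x \<partial>P)"
    unfolding \<nu>_def using A(1) by (intro emeasure_density) auto
  finally show ?thesis by (simp add: L_def)
qed

section \<open>The filtration of the cascade\<close>

lemma space_filt: "space (filt b n) = space (config_space b)"
  by (auto simp: filt_def sigma_W_def space_measure_of_conv)

lemma measurable_W: "\<gamma> \<in> words b \<Longrightarrow> W \<gamma> \<in> config_space b \<rightarrow>\<^sub>M half_line"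
  unfolding W_def config_space_def by (rule measurable_component_singleton)

lemma sets_filt:
  "sets (filt b n) = sigma_sets (space (config_space b))
     {W \<gamma> -` A \<inter> space (config_space b) | \<gamma> A. \<gamma> \<in> words b \<and> length \<gamma> \<le> n \<and> A \<in> sets half_line}"
  unfolding filt_def sigma_W_def by (subst sets_measure_of) auto

lemma filtration_filt: "filtration (space (config_space b)) (filt b)"
proof
  show "sets (filt b m) \<le> sets (filt b n)" if "m \<le> n" for m n
    unfolding sets_filt using that by (intro sigma_sets_mono') fastforce
qed (rule space_filt)

lemma sets_filt_subset: "sets (filt b n) \<subseteq> sets (config_space b)"
  unfolding sets_filt by (intro sets.sigma_sets_subset) (auto intro: measurable_sets measurable_W)

lemma sets_config_space_eq_filt:
  "sets (config_space b) = sigma_sets (space (config_space b)) (\<Union>n. sets (filt b n))" (is "_ = ?G")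
proof
  have "{\<omega> \<in> space (config_space b). \<omega> \<gamma> \<in> A} \<in> sets (filt b (length \<gamma>))"
    if "\<gamma> \<in> words b" "A \<in> sets half_line" for \<gamma> A
  proof -
    have "W \<gamma> -` A \<inter> space (config_space b) \<in> sets (filt b (length \<gamma>))"
      unfolding sets_filt using that by (intro sigma_sets.Basic) blast
    also have "W \<gamma> -` A \<inter> space (config_space b) = {\<omega> \<in> space (config_space b). \<omega> \<gamma> \<in> A}"
      by (auto simp: W_def)
    finally show ?thesis .
  qed
  then show "sets (config_space b) \<subseteq> ?G"
    unfolding config_space_def sets_PiM_single space_PiM
    by (intro sigma_sets_mono') blast
  show "?G \<subseteq> sets (config_space b)"
    using sets_filt_subset by (intro sets.sigma_sets_subset) blast
qed

section \<open>Total mass at a fixed level\<close>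

lemma prob_space_haar: "b > 0 \<Longrightarrow> prob_space (haar b)"
  unfolding haar_def
  by (intro prob_space_PiM prob_space_uniform_count_measure) auto

lemma trunc_in_words: "t \<in> space (haar b) \<Longrightarrow> trunc t n \<in> words b"
  by (auto simp: trunc_def words_def space_haar Pi_iff)

lemma take_trunc: "j \<le> n \<Longrightarrow> take j (trunc t n) = trunc t j"
  by (simp add: trunc_def take_map)

lemma QF_cong: "trunc s n = trunc t n \<Longrightarrow> QF F n s \<omega> = QF F n t \<omega>"
  unfolding QF_def by (metis (no_types, lifting) atMost_iff prod.cong take_trunc)

text \<open>
  The martingale hypothesis speaks of boundary points, whereas the total mass at level \<open>n\<close> is a
  sum over words. Each word is therefore represented by one boundary point through it.
\<close>

definition zero_extension :: "nat list \<Rightarrow> nat \<Rightarrow> nat" where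
  "zero_extension \<gamma> i = (if i < length \<gamma> then \<gamma> ! i else 0)"

lemma trunc_zero_extension: "length \<gamma> = n \<Longrightarrow> trunc (zero_extension \<gamma>) n = \<gamma>"
  by (auto simp: trunc_def zero_extension_def intro: nth_equalityI)

lemma zero_extension_in_haar: "b > 0 \<Longrightarrow> \<gamma> \<in> words b \<Longrightarrow> zero_extension \<gamma> \<in> space (haar b)"
  by (auto simp: space_haar zero_extension_def words_def lists_eq_set subset_iff)

definition words_of_length :: "nat \<Rightarrow> nat \<Rightarrow> nat list set" where
  "words_of_length b n = {\<gamma> \<in> words b. length \<gamma> = n}"

lemma finite_words_of_length: "finite (words_of_length b n)"
  using finite_lists_length_eq[of "{..<b}" n]
  by (auto simp: words_of_length_def words_def lists_eq_set)

definition cyl :: "nat \<Rightarrow> nat list \<Rightarrow> (nat \<Rightarrow> nat) set" where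
  "cyl b \<gamma> = {t \<in> space (haar b). trunc t (length \<gamma>) = \<gamma>}"

lemma sets_cyl: "cyl b \<gamma> \<in> sets (haar b)"
proof -
  have coord: "{t \<in> space (haar b). t i = k} \<in> sets (haar b)" for i k
  proof -
    have "{t \<in> space (haar b). t i \<in> {k} \<inter> {..<b}} \<in> sets (haar b)"
      unfolding haar_def by (rule sets_Collect_single) (auto simp: sets_uniform_count_measure)
    also have "{t \<in> space (haar b). t i \<in> {k} \<inter> {..<b}} = {t \<in> space (haar b). t i = k}"
      by (auto simp: space_haar)
    finally show ?thesis .
  qed
  have "trunc t (length \<gamma>) = \<gamma> \<longleftrightarrow> (\<forall>i\<in>{..<length \<gamma>}. t i = \<gamma> ! i)" for t
    unfolding trunc_def by (subst list_eq_iff_nth_eq) auto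
  then have "cyl b \<gamma> = {t \<in> space (haar b). \<forall>i\<in>{..<length \<gamma>}. t i = \<gamma> ! i}"
    unfolding cyl_def by simp
  also have "\<dots> \<in> sets (haar b)"
    by (intro sets.sets_Collect_finite_All coord) auto
  finally show ?thesis .
qed

text \<open>
  As \<open>QF F n\<close> depends on \<open>t\<close> only through its first \<open>n\<close> letters, it is a step function of \<open>t\<close>.
  Integrating over \<open>T\<close> thus becomes a finite sum, and measurability and integrability in \<open>\<omega>\<close> follow
  from those of the martingales at finitely many boundary points.
\<close>

lemma QF_eq_sum_cyl:
  assumes "t \<in> space (haar b)"
  shows "QF F n t \<omega> =
    (\<Sum>\<gamma>\<in>words_of_length b n. indicator (cyl b \<gamma>) t * QF F n (zero_extension \<gamma>) \<omega>)"
proof -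
  have "indicator (cyl b \<gamma>) t * QF F n (zero_extension \<gamma>) \<omega> = (if \<gamma> = trunc t n then QF F n t \<omega> else 0)"
    if "\<gamma> \<in> words_of_length b n" for \<gamma>
    using that assms QF_cong[of "zero_extension \<gamma>" n t F \<omega>]
    by (auto simp: words_of_length_def cyl_def trunc_zero_extension)
  moreover have "trunc t n \<in> words_of_length b n"
    using assms by (simp add: words_of_length_def trunc_in_words) (simp add: trunc_def)
  ultimately show ?thesis
    using finite_words_of_length[of b n] by simp
qed

text \<open>
  A real-valued version of \<open>\<lambda>\<^bsub>F,n\<^esub>(T)\<close>, because the defining property of \<open>\<Q>\<close> is stated with
  Bochner integrals.
\<close>

definition level_mass ::
  "nat \<Rightarrow> (nat list \<Rightarrow> (nat list \<Rightarrow> real) \<Rightarrow> real) \<Rightarrow> nat \<Rightarrow> (nat list \<Rightarrow> real) \<Rightarrow> real" where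
  "level_mass b F n \<omega> = (\<integral>t. QF F n t \<omega> \<partial>haar b)"

context
  fixes b P F
  assumes b: "b > 0" and weight: "weight_system b P F"
begin

interpretation haar: prob_space "haar b"
  using b by (rule prob_space_haar)

lemma integrable_QF: "integrable (haar b) (\<lambda>t. QF F n t \<omega>)"
proof (subst Bochner_Integration.integrable_cong[OF refl QF_eq_sum_cyl])
  show "integrable (haar b)
      (\<lambda>t. \<Sum>\<gamma>\<in>words_of_length b n. indicator (cyl b \<gamma>) t * QF F n (zero_extension \<gamma>) \<omega>)"
    by (rule Bochner_Integration.integrable_sum, rule integrable_mult_left,
        rule integrable_real_indicator) (simp_all add: sets_cyl haar.emeasure_eq_measure)
qed

lemma level_mass_eq_sum:
  "level_mass b F n \<omega> =
    (\<Sum>\<gamma>\<in>words_of_length b n. measure (haar b) (cyl b \<gamma>) * QF F n (zero_extension \<gamma>) \<omega>)"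
proof -
  have "integrable (haar b) (indicator (cyl b \<gamma>) :: _ \<Rightarrow> real)" for \<gamma>
    by (rule integrable_real_indicator) (simp_all add: sets_cyl haar.emeasure_eq_measure)
  moreover have "level_mass b F n \<omega> = (\<integral>t. (\<Sum>\<gamma>\<in>words_of_length b n.
      indicator (cyl b \<gamma>) t * QF F n (zero_extension \<gamma>) \<omega>) \<partial>haar b)"
    unfolding level_mass_def by (intro Bochner_Integration.integral_cong refl QF_eq_sum_cyl)
  ultimately show ?thesis
    by (simp add: sets_cyl sets.Int_space_eq2)
qed

lemma QF_nonneg: "t \<in> space (haar b) \<Longrightarrow> \<omega> \<in> space (config_space b) \<Longrightarrow> 0 \<le> QF F n t \<omega>"
  using weight by (auto simp: weight_system_def positive_T_martingale_def)

lemma level_mass_nonneg: "\<omega> \<in> space (config_space b) \<Longrightarrow> 0 \<le> level_mass b F n \<omega>"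
  unfolding level_mass_def using QF_nonneg by (intro integral_nonneg_AE AE_I2) auto

lemma emeasure_lambdaF:
  assumes "\<omega> \<in> space (config_space b)"
  shows "emeasure (lambdaF b F n \<omega>) (space (haar b)) = ennreal (level_mass b F n \<omega>)"
proof -
  have "emeasure (lambdaF b F n \<omega>) (space (haar b)) = (\<integral>\<^sup>+t. ennreal (QF F n t \<omega>) \<partial>haar b)"
    unfolding lambdaF_def using borel_measurable_integrable[OF integrable_QF]
    by (subst emeasure_density) (auto intro!: nn_integral_cong)
  also have "\<dots> = ennreal (level_mass b F n \<omega>)"
    unfolding level_mass_def using assms QF_nonneg
    by (intro nn_integral_eq_integral integrable_QF AE_I2) auto
  finally show ?thesis .
qed

lemma martingale_QF: "\<gamma> \<in> words b \<Longrightarrow> martingale_wrt P (filt b) (\<lambda>n. QF F n (zero_extension \<gamma>))"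
  using weight zero_extension_in_haar[OF b]
  by (auto simp: weight_system_def positive_T_martingale_def)

lemma measurable_level_mass: "level_mass b F n \<in> borel_measurable (filt b n)"
  unfolding level_mass_eq_sum[abs_def]
  using martingale_QF
  by (intro borel_measurable_sum borel_measurable_times)
     (auto simp: martingale_wrt_def words_of_length_def)

lemma integrable_level_mass: "integrable P (level_mass b F n)"
  unfolding level_mass_eq_sum[abs_def]
  using martingale_QF
  by (intro Bochner_Integration.integrable_sum integrable_mult_right)
     (auto simp: martingale_wrt_def words_of_length_def)

lemma measurable_lambdaF:
  "(\<lambda>\<omega>. emeasure (lambdaF b F n \<omega>) (space (haar b))) \<in> borel_measurable (filt b n)"
proof (subst measurable_cong[OF emeasure_lambdaF])
  show "(\<lambda>\<omega>. ennreal (level_mass b F n \<omega>)) \<in> borel_measurable (filt b n)"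
    using measurable_level_mass by measurable
qed (simp add: space_filt)

text \<open>
  The test function is the indicator of \<open>A \<times> T\<close>, whose inner integral over \<open>T\<close> is the total mass on
  \<open>A\<close>. The constant \<open>Z\<inverse>\<close> is absorbed into the reference measure, so that it need not be moved
  through the limsup later.
\<close>

lemma cascade_prob_filt:
  assumes sets_P: "sets P = sets (config_space b)"
    and Z: "Z_root P F > 0" and Q: "is_cascade_prob b P F \<Q>" and A: "A \<in> sets (filt b n)"
  shows "emeasure (distr \<Q> (config_space b) fst) A =
    (\<integral>\<^sup>+\<omega>\<in>A. emeasure (lambdaF b F n \<omega>) (space (haar b))
        \<partial>scale_measure (ennreal (inverse (Z_root P F))) P)"
proof -
  interpret Q: prob_space \<Q> using Q by (simp add: is_cascade_prob_def)
  have sets_Q [measurable_cong]: "sets \<Q> = sets (config_space b \<Otimes>\<^sub>M haar b)"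
    using Q by (simp add: is_cascade_prob_def)
  have A_conf [measurable]: "A \<in> sets (config_space b)"
    using A sets_filt_subset by blast
  have A_sub: "A \<subseteq> space (config_space b)"
    by (rule sets.sets_into_space[OF A_conf])
  have space_P: "space P = space (config_space b)"
    by (rule sets_eq_imp_space_eq[OF sets_P])
  have A_P [measurable]: "A \<in> sets P" by (simp add: sets_P)
  have mass_P [measurable]: "level_mass b F n \<in> borel_measurable P"
    using integrable_level_mass by (rule borel_measurable_integrable)
  let ?f = "indicator (A \<times> space (haar b)) :: _ \<Rightarrow> real"
  have cyl_eq: "fst -` A \<inter> space \<Q> = A \<times> space (haar b)"
    using A_sub by (auto simp: sets_eq_imp_space_eq[OF sets_Q] space_pair_measure)
  have "A \<times> space (haar b) \<in> sets \<Q>"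
    unfolding sets_Q by measurable
  then have "measure \<Q> (A \<times> space (haar b)) = (\<integral>z. ?f z \<partial>\<Q>)"
    by simp
  also have "\<dots> = inverse (Z_root P F) * (\<integral>\<omega>. (\<integral>t. ?f (\<omega>, t) * QF F n t \<omega> \<partial>haar b) \<partial>P)"
  proof -
    have "?f \<in> borel_measurable (filt b n \<Otimes>\<^sub>M haar b)"
      using A by measurable
    moreover have "bounded (?f ` space (config_space b \<Otimes>\<^sub>M haar b))"
      by (rule bounded_subset[of "{0, 1}"]) (auto simp: indicator_def)
    ultimately show ?thesis
      using Q unfolding is_cascade_prob_def by blast
  qed
  also have "(\<integral>\<omega>. (\<integral>t. ?f (\<omega>, t) * QF F n t \<omega> \<partial>haar b) \<partial>P) = (\<integral>\<omega>. indicator A \<omega> * level_mass b F n \<omega> \<partial>P)"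
  proof (intro Bochner_Integration.integral_cong refl)
    fix \<omega>
    have "(\<integral>t. ?f (\<omega>, t) * QF F n t \<omega> \<partial>haar b) = (\<integral>t. indicator A \<omega> * QF F n t \<omega> \<partial>haar b)"
      by (intro Bochner_Integration.integral_cong) (auto simp: indicator_def)
    then show "(\<integral>t. ?f (\<omega>, t) * QF F n t \<omega> \<partial>haar b) = indicator A \<omega> * level_mass b F n \<omega>"
      by (simp add: level_mass_def)
  qed
  finally have "emeasure \<Q> (A \<times> space (haar b)) =
      ennreal (inverse (Z_root P F)) * ennreal (\<integral>\<omega>. indicator A \<omega> * level_mass b F n \<omega> \<partial>P)"
    using Z by (simp add: Q.emeasure_eq_measure ennreal_mult')
  also have "ennreal (\<integral>\<omega>. indicator A \<omega> * level_mass b F n \<omega> \<partial>P)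
      = (\<integral>\<^sup>+\<omega>. ennreal (indicator A \<omega> * level_mass b F n \<omega>) \<partial>P)"
    using integrable_mult_indicator[OF A_P integrable_level_mass] level_mass_nonneg
    by (intro nn_integral_eq_integral[symmetric] AE_I2) (auto simp: space_P indicator_def)
  also have "\<dots> = (\<integral>\<^sup>+\<omega>\<in>A. emeasure (lambdaF b F n \<omega>) (space (haar b)) \<partial>P)"
    using emeasure_lambdaF by (intro nn_integral_cong) (auto simp: space_P indicator_def)
  finally have "emeasure \<Q> (A \<times> space (haar b)) = ennreal (inverse (Z_root P F)) *
      (\<integral>\<^sup>+\<omega>\<in>A. emeasure (lambdaF b F n \<omega>) (space (haar b)) \<partial>P)" .
  moreover have "(\<lambda>\<omega>. emeasure (lambdaF b F n \<omega>) (space (haar b)) * indicator A \<omega>) \<in> borel_measurable P"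
  proof (subst measurable_cong)
    show "(\<lambda>\<omega>. ennreal (level_mass b F n \<omega>) * indicator A \<omega>) \<in> borel_measurable P"
      by measurable
  qed (simp add: emeasure_lambdaF space_P)
  moreover have "emeasure (distr \<Q> (config_space b) fst) A = emeasure \<Q> (A \<times> space (haar b))"
    by (subst emeasure_distr) (auto simp: cyl_eq)
  ultimately show ?thesis
    by (simp add: nn_integral_scale_measure)
qed

end

section \<open>The decomposition\<close>

theorem theorem2p1:
  fixes b :: nat
    and p0 :: "real measure"
    and q :: "nat \<Rightarrow> (nat \<Rightarrow> real) \<Rightarrow> real measure"
    and P :: "(nat list \<Rightarrow> real) measure"
    and F :: "nat list \<Rightarrow> (nat list \<Rightarrow> real) \<Rightarrow> real"
    and \<Q> :: "((nat list \<Rightarrow> real) \<times> (nat \<Rightarrow> nat)) measure"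
  assumes "b \<ge> 2"
    and "cascade_generator b p0 q P"
    and "weight_system b P F"
    and "Z_root P F > 0"
    and "is_cascade_prob b P F \<Q>"
  shows "\<forall>A\<in>sets (config_space b).
    emeasure (distr \<Q> (config_space b) fst) A =
      emeasure (density P (\<lambda>\<omega>. ennreal (inverse (Z_root P F)) * lambdaF_inf_T b F \<omega>
                               * indicator {\<omega>. lambdaF_inf_T b F \<omega> < \<infinity>} \<omega>)) A
    + emeasure (density (distr \<Q> (config_space b) fst)
                  (indicator {\<omega>. lambdaF_inf_T b F \<omega> = \<infinity>})) A"
proof
  fix A assume A [measurable]: "A \<in> sets (config_space b)"
  have b: "b > 0" using assms(1) by simp
  interpret P: prob_space P using assms(2) by (simp add: cascade_generator_def)
  interpret Q: prob_space \<Q> using assms(5) by (simp add: is_cascade_prob_def)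
  have sets_P [measurable_cong]: "sets P = sets (config_space b)"
    using assms(2) by (simp add: cascade_generator_def)
  have space_P: "space P = space (config_space b)"
    by (rule sets_eq_imp_space_eq[OF sets_P])
  have sets_Q [measurable_cong]: "sets \<Q> = sets (config_space b \<Otimes>\<^sub>M haar b)"
    using assms(5) by (simp add: is_cascade_prob_def)
  define \<mu> where "\<mu> = distr \<Q> (config_space b) fst"
  define L where "L = lambdaF_inf_T b F"
  define c where "c = ennreal (inverse (Z_root P F))"
  interpret \<mu>: prob_space \<mu>
    unfolding \<mu>_def by (rule Q.prob_space_distr) measurable
  have sets_\<mu> [measurable_cong]: "sets \<mu> = sets (config_space b)" by (simp add: \<mu>_def)
  note lambdaF_filt = measurable_lambdaF[OF b assms(3)]
  have "subalgebra (config_space b) (filt b n)" for n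
    using sets_filt_subset by (auto simp: subalgebra_def space_filt)
  then have [measurable]:
      "(\<lambda>\<omega>. emeasure (lambdaF b F n \<omega>) (space (haar b))) \<in> borel_measurable (config_space b)" for n
    using lambdaF_filt measurable_from_subalg by blast
  have L [measurable]: "L \<in> borel_measurable (config_space b)"
    unfolding L_def lambdaF_inf_T_def[abs_def] by measurable
  have fin: "finite_measure (scale_measure c P)"
    by (intro finite_measureI) (simp add: c_def P.emeasure_space_1 space_scale_measure)
  have A_sub: "A \<subseteq> space (config_space b)" by (rule sets.sets_into_space[OF A])
  define A\<^sub>0 where "A\<^sub>0 = A \<inter> {\<omega> \<in> space (config_space b). L \<omega> < \<infinity>}"
  define A\<^sub>1 where "A\<^sub>1 = A \<inter> {\<omega> \<in> space (config_space b). L \<omega> = \<infinity>}"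
  have [measurable]: "A\<^sub>0 \<in> sets (config_space b)" "A\<^sub>1 \<in> sets (config_space b)"
    unfolding A\<^sub>0_def A\<^sub>1_def by measurable
  have "A = A\<^sub>0 \<union> A\<^sub>1" "A\<^sub>0 \<inter> A\<^sub>1 = {}"
    using A_sub by (auto simp: A\<^sub>0_def A\<^sub>1_def less_top)
  then have "emeasure \<mu> A = emeasure \<mu> A\<^sub>0 + emeasure \<mu> A\<^sub>1"
    by (simp add: plus_emeasure sets_\<mu>)
  also have "emeasure \<mu> A\<^sub>0 = (\<integral>\<^sup>+\<omega>\<in>A\<^sub>0. L \<omega> \<partial>scale_measure c P)"
    unfolding L_def lambdaF_inf_T_def
  proof (rule density_limsup[OF fin, where F = "filt b"])
    show "filtration (space (scale_measure c P)) (filt b)"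
      by (simp add: space_scale_measure space_P filtration_filt)
    show "sets (scale_measure c P) = sigma_sets (space (scale_measure c P)) (\<Union>n. sets (filt b n))"
      by (simp add: space_scale_measure space_P sets_P sets_config_space_eq_filt)
    show "limsup (\<lambda>n. emeasure (lambdaF b F n \<omega>) (space (haar b))) < \<infinity>" if "\<omega> \<in> A\<^sub>0" for \<omega>
      using that by (simp add: A\<^sub>0_def L_def lambdaF_inf_T_def)
  qed (use lambdaF_filt cascade_prob_filt[OF b assms(3) sets_P assms(4,5)]
        \<mu>.finite_measure_axioms in \<open>auto simp: \<mu>_def c_def sets_P\<close>)
  also have "\<dots> = (\<integral>\<^sup>+\<omega>. c * (L \<omega> * indicator A\<^sub>0 \<omega>) \<partial>P)"
    by (simp add: nn_integral_scale_measure nn_integral_cmult)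
  also have "\<dots> = (\<integral>\<^sup>+\<omega>\<in>A. (c * L \<omega> * indicator {\<omega>. L \<omega> < \<infinity>} \<omega>) \<partial>P)"
    using A_sub by (intro nn_integral_cong) (auto simp: A\<^sub>0_def space_P split: split_indicator)
  also have "\<dots> = emeasure (density P (\<lambda>\<omega>. c * L \<omega> * indicator {\<omega>. L \<omega> < \<infinity>} \<omega>)) A"
    by (subst emeasure_density) (auto simp: sets_P)
  also have "emeasure \<mu> A\<^sub>1 = (\<integral>\<^sup>+\<omega>. indicator A\<^sub>1 \<omega> \<partial>\<mu>)"
    by simp
  also have "\<dots> = (\<integral>\<^sup>+\<omega>\<in>A. indicator {\<omega>. L \<omega> = \<infinity>} \<omega> \<partial>\<mu>)"
    using A_sub by (intro nn_integral_cong) (auto simp: A\<^sub>1_def split: split_indicator)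
  also have "\<dots> = emeasure (density \<mu> (indicator {\<omega>. L \<omega> = \<infinity>})) A"
    by (subst emeasure_density) (auto simp: sets_\<mu>)
  finally show "emeasure (distr \<Q> (config_space b) fst) A =
      emeasure (density P (\<lambda>\<omega>. ennreal (inverse (Z_root P F)) * lambdaF_inf_T b F \<omega>
                               * indicator {\<omega>. lambdaF_inf_T b F \<omega> < \<infinity>} \<omega>)) A
    + emeasure (density (distr \<Q> (config_space b) fst)
                  (indicator {\<omega>. lambdaF_inf_T b F \<omega> = \<infinity>})) A"
    by (simp add: \<mu>_def c_def L_def)
qed

end
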